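(* Consider the quantum interrogation prepare-and-measure scenario described in the context, with operational quantities $r_{\theta0},r_{\theta1},r_{\theta^\dagger0},r_{\theta^\dagger1},r_{\theta\theta^\dagger}$, satisfying the symmetries $$ r_{\theta0}=r_{\theta^\dagger0},\qquad r_{\theta1}=r_{\theta^\dagger1},\qquad r_{\theta\theta^\dagger}=(r_{\theta0}-r_{\theta1})^2 . $$ Let the efficiency be $$ \eta=\frac{r_{\theta0}\,r_{\theta^\dagger1}}{r_{\theta0}\,r_{\theta^\dagger1}+r_{\theta1}} . $$ (i) Under the first two symmetries the efficiency can be rewritten as a function of $r_{\theta0}$ only, $$ \eta=\frac{r_{\theta0}}{r_{\theta0}+1}, $$ and if the statistics of the scenario are explained by a preparation noncontextual ontological model, then $$ \eta\;\le\;\eta^{NC}_{opt}:=\frac{1+(2r_{\theta0}-1)^2}{2(r_{\theta0}+1)} . $$ (ii) The quantum realization described in the context satisfies all constraints of the scenario and the three symmetries above, with $r_{\theta0}=\cos^2\theta$, and hence has efficiency $\eta=\frac{r_{\theta0}}{r_{\theta0}+1}$. At $r_{\theta0}=1/2$ the quantum efficiency $\eta$ and the noncontextual bound $\eta^{NC}_{opt}$ are both equal to $1/3$. For some choices of $r_{\theta0}$ the quantum efficiency exceeds the noncontextual bound, and the maximum gap over $r_{\theta0}\in[0,1]$ is $$ \max_{r_{\theta0}}\left(\eta-\eta^{NC}_{opt}\right)\approx0.071, \qquad\text{attained at } r_{\theta0}=\sqrt3-1\approx0.73 . $$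
   Context: Scenario. There are preparations $P_1,P_2,P_3$ and $P_{1^\perp},P_{2^\perp},P_{3^\perp}$ and binary-outcome measurements $M_1,M_2,M_3$ with outcomes $\{0,1\}$. Let $p(k\mid M,P)$ be the probability of outcome $k$ when preparation $P$ is followed by measurement $M$. The constraints are: - operational equivalences $\tfrac12P_1+\tfrac12P_{1^\perp}\simeq\tfrac12P_2+\tfrac12P_{2^\perp}\simeq\tfrac12P_3+\tfrac12P_{3^\perp}$ between equal-weight mixtures of preparations; - $p(0\mid M_i,P_i)=1$ and $p(0\mid M_i,P_{i^\perp})=0$ for $i=1,2,3$ (ideal measurements); - symmetry $p(0\mid M_i,P_j)=p(0\mid M_j,P_i)$ for all $i,j\in\{1,2,3\}$. Notation: $r_{\theta0}=p(0\mid M_1,P_2)=p(0\mid M_2,P_1)$, $r_{\theta1}=p(1\mid M_1,P_2)=1-r_{\theta0}$, $r_{\theta^\dagger0}=p(0\mid M_3,P_1)=p(0\mid M_1,P_3)$, $r_{\theta^\dagger1}=p(1\mid M_3,P_1)=1-r_{\theta^\dagger0}$, $r_{\theta\theta^\dagger}=p(0\mid M_2,P_3)=p(0\mid M_3,P_2)$. Interpretation: in the bomb-testing interferometer, $r_{\theta0}r_{\theta^\dagger1}$ is the probability of successfully detecting the bomb without explosion and $r_{\theta1}$ the probability of explosion. In the limiting case $r_{\theta1}=0$, where the defining quotient of $\eta$ reads $0/0$, the efficiency is understood through the rewritten expression $r_{\theta0}/(r_{\theta0}+1)$, obtained by cancelling the common factor $r_{\theta1}=r_{\theta^\dagger1}$.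 Quantum realization for parameter $\theta\in\mathbb{R}$: on $\mathbb{C}^2$ with orthonormal basis $|0\rangle,|1\rangle$, let $U_\theta=\begin{pmatrix}\cos\theta&i\sin\theta\\ i\sin\theta&\cos\theta\end{pmatrix}$. $P_1,P_2,P_3$ prepare $|\psi_1\rangle=|0\rangle$, $|\psi_2\rangle=U_\theta|0\rangle$, $|\psi_3\rangle=U_\theta^\dagger|0\rangle$; $P_{i^\perp}$ prepares the pure state orthogonal to $|\psi_i\rangle$; $M_i$ is the measurement $\{|\psi_i\rangle\langle\psi_i|,\ \mathbb{1}-|\psi_i\rangle\langle\psi_i|\}$ with outcomes $0,1$ respectively. Probabilities are given by the Born rule, and in quantum theory operational equivalence of (mixtures of) preparations means equality of the corresponding density matrices. Ontological model. It consists of a measure space $\Lambda$, a probability density $\mu_P\ge0$, $\int_\Lambda\mu_P(\lambda)\,d\lambda=1$, for each preparation $P$, and measurable response functions $\xi(k\mid M,\lambda)\ge0$ with $\sum_k\xi(k\mid M,\lambda)=1$. It explains the statistics if $p(k\mid M,P)=\int_\Lambda\xi(k\mid M,\lambda)\mu_P(\lambda)\,d\lambda$ for all $k,M,P$. A mixture $\tfrac12P+\tfrac12P'$ is represented by $\tfrac12\mu_P+\tfrac12\mu_{P'}$. The model is preparation noncontextual if operationally equivalent preparations (including mixtures) are represented by the same density; here this means $\tfrac12\mu_{P_1}+\tfrac12\mu_{P_{1^\perp}}=\tfrac12\mu_{P_2}+\tfrac12\mu_{P_{2^\perp}}=\tfrac12\mu_{P_3}+\tfrac12\mu_{P_{3^\perp}}$.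 *)

theory Defs
  imports "HOL-Analysis.Analysis"
begin

datatype label = L1 | L2 | L3

datatype prep = Prep label | PrepPerp label

datatype meas = Meas label

datatype outcome = Out0 | Out1

text \<open>\<open>p k M P\<close> is the probability \<open>p(k | M, P)\<close>.\<close>

type_synonym statistics = "outcome \<Rightarrow> meas \<Rightarrow> prep \<Rightarrow> real"

definition probabilities :: "statistics \<Rightarrow> bool" where
  "probabilities p \<longleftrightarrow>
     (\<forall>k M P. 0 \<le> p k M P) \<and> (\<forall>M P. p Out0 M P + p Out1 M P = 1)"

text \<open>Equal-weight mixtures are compared by their statistics for the measurements of the scenario;
  \<open>quantum_equivalences\<close> below is the stronger equality of density matrices.\<close>

definition operational_equivalences :: "statistics \<Rightarrow> bool" where
  "operational_equivalences p \<longleftrightarrow>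
     (\<forall>i j k M. 1/2 * p k M (Prep i) + 1/2 * p k M (PrepPerp i)
              = 1/2 * p k M (Prep j) + 1/2 * p k M (PrepPerp j))"

definition ideal_measurements :: "statistics \<Rightarrow> bool" where
  "ideal_measurements p \<longleftrightarrow>
     (\<forall>i. p Out0 (Meas i) (Prep i) = 1 \<and> p Out0 (Meas i) (PrepPerp i) = 0)"

definition symmetric_statistics :: "statistics \<Rightarrow> bool" where
  "symmetric_statistics p \<longleftrightarrow>
     (\<forall>i j. p Out0 (Meas i) (Prep j) = p Out0 (Meas j) (Prep i))"

definition interrogation_scenario :: "statistics \<Rightarrow> bool" where
  "interrogation_scenario p \<longleftrightarrow>
     probabilities p \<and> operational_equivalences p \<and>
     ideal_measurements p \<and> symmetric_statistics p"

text \<open>The suffix \<open>dag\<close> stands for \<open>\<theta>\<close> with a dagger.\<close>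

definition r_theta0 :: "statistics \<Rightarrow> real" where
  "r_theta0 p = p Out0 (Meas L1) (Prep L2)"

definition r_theta1 :: "statistics \<Rightarrow> real" where
  "r_theta1 p = p Out1 (Meas L1) (Prep L2)"

definition r_dag0 :: "statistics \<Rightarrow> real" where
  "r_dag0 p = p Out0 (Meas L3) (Prep L1)"

definition r_dag1 :: "statistics \<Rightarrow> real" where
  "r_dag1 p = p Out1 (Meas L3) (Prep L1)"

definition r_theta_dag :: "statistics \<Rightarrow> real" where
  "r_theta_dag p = p Out0 (Meas L2) (Prep L3)"

text \<open>For probabilities, the denominator vanishes only if \<open>r_theta1 p = 0\<close> and \<open>r_dag1 p = 0\<close>,
  where the quotient reads 0/0. In that limiting case the efficiency is by convention the
  expression obtained by first cancelling the common factor \<open>r_theta1 p = r_dag1 p\<close>.\<close>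

definition efficiency :: "statistics \<Rightarrow> real" where
  "efficiency p =
     (if r_theta0 p * r_dag1 p + r_theta1 p = 0 then r_theta0 p / (r_theta0 p + 1)
      else r_theta0 p * r_dag1 p / (r_theta0 p * r_dag1 p + r_theta1 p))"

definition eta_NC_opt :: "real \<Rightarrow> real" where
  "eta_NC_opt r = (1 + (2 * r - 1)^2) / (2 * (r + 1))"

definition gap :: "statistics \<Rightarrow> real" where
  "gap p = efficiency p - eta_NC_opt (r_theta0 p)"

definition ontological_model ::
    "'l measure \<Rightarrow> (prep \<Rightarrow> 'l \<Rightarrow> real) \<Rightarrow> (outcome \<Rightarrow> meas \<Rightarrow> 'l \<Rightarrow> real) \<Rightarrow> bool" where
  "ontological_model \<Lambda> \<mu> \<xi> \<longleftrightarrow>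
     (\<forall>P. integrable \<Lambda> (\<mu> P) \<and> (\<forall>l\<in>space \<Lambda>. 0 \<le> \<mu> P l) \<and> (\<integral>l. \<mu> P l \<partial>\<Lambda>) = 1) \<and>
     (\<forall>k M. \<xi> k M \<in> borel_measurable \<Lambda> \<and> (\<forall>l\<in>space \<Lambda>. 0 \<le> \<xi> k M l)) \<and>
     (\<forall>M. \<forall>l\<in>space \<Lambda>. \<xi> Out0 M l + \<xi> Out1 M l = 1)"

definition explains ::
    "'l measure \<Rightarrow> (prep \<Rightarrow> 'l \<Rightarrow> real) \<Rightarrow> (outcome \<Rightarrow> meas \<Rightarrow> 'l \<Rightarrow> real) \<Rightarrow> statistics \<Rightarrow> bool" where
  "explains \<Lambda> \<mu> \<xi> p \<longleftrightarrow> (\<forall>k M P. p k M P = (\<integral>l. \<xi> k M l * \<mu> P l \<partial>\<Lambda>))"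

text \<open>Densities are identified when they agree almost everywhere.\<close>

definition preparation_noncontextual :: "'l measure \<Rightarrow> (prep \<Rightarrow> 'l \<Rightarrow> real) \<Rightarrow> bool" where
  "preparation_noncontextual \<Lambda> \<mu> \<longleftrightarrow>
     (\<forall>i j. AE l in \<Lambda>. 1/2 * \<mu> (Prep i) l + 1/2 * \<mu> (PrepPerp i) l
                     = 1/2 * \<mu> (Prep j) l + 1/2 * \<mu> (PrepPerp j) l)"

definition projector :: "complex^2 \<Rightarrow> complex^2^2" where
  "projector v = (\<chi> i j. v $ i * cnj (v $ j))"

definition adjoint_matrix :: "complex^2^2 \<Rightarrow> complex^2^2" where
  "adjoint_matrix A = (\<chi> i j. cnj (A $ j $ i))"

definition orthogonal_states :: "complex^2 \<Rightarrow> complex^2 \<Rightarrow> bool" where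
  "orthogonal_states v w \<longleftrightarrow> (\<Sum>i\<in>UNIV. cnj (v $ i) * w $ i) = 0"

definition ket0 :: "complex^2" where
  "ket0 = vector [1, 0]"

definition U :: "real \<Rightarrow> complex^2^2" where
  "U \<theta> = vector [vector [of_real (cos \<theta>), \<i> * of_real (sin \<theta>)],
                 vector [\<i> * of_real (sin \<theta>), of_real (cos \<theta>)]]"

fun psi :: "real \<Rightarrow> label \<Rightarrow> complex^2" where
  "psi \<theta> L1 = ket0"
| "psi \<theta> L2 = U \<theta> *v ket0"
| "psi \<theta> L3 = adjoint_matrix (U \<theta>) *v ket0"

text \<open>The vector for \<open>PrepPerp i\<close> is determined
  only up to a phase, so it is characterised rather than chosen.\<close>

definition quantum_preparations :: "real \<Rightarrow> (prep \<Rightarrow> complex^2) \<Rightarrow> bool" where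
  "quantum_preparations \<theta> s \<longleftrightarrow>
     (\<forall>i. s (Prep i) = psi \<theta> i \<and>
          norm (s (PrepPerp i)) = 1 \<and> orthogonal_states (psi \<theta> i) (s (PrepPerp i)))"

fun effect :: "real \<Rightarrow> outcome \<Rightarrow> meas \<Rightarrow> complex^2^2" where
  "effect \<theta> Out0 (Meas i) = projector (psi \<theta> i)"
| "effect \<theta> Out1 (Meas i) = mat 1 - projector (psi \<theta> i)"

definition quantum_statistics :: "real \<Rightarrow> (prep \<Rightarrow> complex^2) \<Rightarrow> statistics" where
  "quantum_statistics \<theta> s k M P = Re (trace (effect \<theta> k M ** projector (s P)))"

definition quantum_equivalences :: "(prep \<Rightarrow> complex^2) \<Rightarrow> bool" where
  "quantum_equivalences s \<longleftrightarrow>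
     (\<forall>i j. (1/2) *\<^sub>R projector (s (Prep i)) + (1/2) *\<^sub>R projector (s (PrepPerp i))
          = (1/2) *\<^sub>R projector (s (Prep j)) + (1/2) *\<^sub>R projector (s (PrepPerp j)))"

end

theory Submission
  imports Defs
begin

text \<open>
  Let \<open>\<mu>\<^sub>i\<close> be the density of \<open>P\<^sub>i\<close> and \<open>\<xi>\<^sub>i\<close> the response function of outcome 0 of \<open>M\<^sub>i\<close>. By
  noncontextuality all sums of the densities of \<open>P\<^sub>i\<close> and its orthogonal partner agree almost
  everywhere with one function \<open>S\<close>, and ideality of \<open>M\<^sub>3\<close> forces \<open>\<mu>\<^sub>3 = \<xi>\<^sub>3 S\<close>. Since \<open>0 \<le> \<mu>\<^sub>1 \<le> S\<close>
  and \<open>x + y - 1 \<le> x y\<close> on the unit square, \<open>\<mu>\<^sub>1 (\<xi>\<^sub>2 + \<xi>\<^sub>3 - 1) \<le> \<xi>\<^sub>2 \<mu>\<^sub>3\<close>; integrating gives the inequality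
  \<open>p(0|M\<^sub>2,P\<^sub>1) + p(0|M\<^sub>3,P\<^sub>1) - p(0|M\<^sub>2,P\<^sub>3) \<le> 1\<close>, which is the bound on the efficiency.
  The quantum gap, written in \<open>u = r + 1\<close>, is \<open>7 - 2 u - 6 / u\<close>, maximal at \<open>u = sqrt 3\<close>.
\<close>

section \<open>Efficiency under the symmetries\<close>

lemma scenario_probabilities:
  assumes "interrogation_scenario p"
  shows "0 \<le> p k M P" "p Out1 M P = 1 - p Out0 M P"
proof -
  have "probabilities p" using assms by (simp add: interrogation_scenario_def)
  then have nn: "\<And>k. 0 \<le> p k M P" and s: "p Out0 M P + p Out1 M P = 1"
    by (auto simp: probabilities_def)
  show "0 \<le> p k M P" by (rule nn)
  show "p Out1 M P = 1 - p Out0 M P" using s by simp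
qed

lemma efficiency_cancel:
  assumes "r_theta1 p = r_dag1 p" "r_theta1 p \<noteq> 0"
  shows "r_theta0 p * r_dag1 p / (r_theta0 p * r_dag1 p + r_theta1 p) = r_theta0 p / (r_theta0 p + 1)"
proof -
  have "r_theta0 p * r_dag1 p / (r_theta0 p * r_dag1 p + r_theta1 p)
      = r_theta0 p * r_theta1 p / ((r_theta0 p + 1) * r_theta1 p)"
    using assms(1) by (simp add: distrib_right)
  \<comment> \<open>If \<open>r_theta0 p + 1\<close> is zero, both sides are 0, as division by zero
    gives 0.\<close>
  then show ?thesis using assms(2) by simp
qed

lemma efficiency_rewrite:
  assumes "r_theta1 p = r_dag1 p"
  shows "efficiency p = r_theta0 p / (r_theta0 p + 1)"
proof (cases "r_theta1 p = 0")
  case True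
  then show ?thesis using assms by (simp add: efficiency_def)
next
  case False
  \<comment> \<open>Both branches of \<open>efficiency\<close> have the claimed value here, whether
    or not the denominator vanishes.\<close>
  then show ?thesis using efficiency_cancel[OF assms False] by (simp add: efficiency_def)
qed

section \<open>Ontological models and the noncontextual bound\<close>

lemma ontological_model_outcome_le_1:
  assumes "ontological_model \<Lambda> \<mu> \<xi>" "l \<in> space \<Lambda>"
  shows "\<xi> k M l \<le> 1"
proof -
  have "0 \<le> \<xi> Out0 M l" "0 \<le> \<xi> Out1 M l" "\<xi> Out0 M l + \<xi> Out1 M l = 1"
    using assms by (auto simp: ontological_model_def)
  then show ?thesis by (cases k) auto
qed

text \<open>Response functions lie in the unit interval, so the product is dominated by the density.
  This justifies linearity of the integral below.\<close>

lemma ontological_model_integrable: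
  assumes "ontological_model \<Lambda> \<mu> \<xi>"
  shows "integrable \<Lambda> (\<lambda>l. \<xi> k M l * \<mu> P l)"
proof (rule Bochner_Integration.integrable_bound)
  show "integrable \<Lambda> (\<mu> P)" using assms by (simp add: ontological_model_def)
  then show "(\<lambda>l. \<xi> k M l * \<mu> P l) \<in> borel_measurable \<Lambda>"
    using assms
    by (intro borel_measurable_times borel_measurable_integrable[of \<Lambda> "\<mu> P"])
      (simp_all add: ontological_model_def)
  show "AE l in \<Lambda>. norm (\<xi> k M l * \<mu> P l) \<le> norm (\<mu> P l)"
  proof (rule AE_I2)
    fix l assume l: "l \<in> space \<Lambda>"
    have "0 \<le> \<xi> k M l" using assms l by (simp add: ontological_model_def)
    moreover have "\<xi> k M l \<le> 1" by (rule ontological_model_outcome_le_1[OF assms l])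
    ultimately show "norm (\<xi> k M l * \<mu> P l) \<le> norm (\<mu> P l)"
      by (simp add: abs_mult mult_left_le_one_le)
  qed
qed

text \<open>A nonnegative function with zero integral vanishes almost everywhere. This turns
  ideality of a measurement into a pointwise constraint.\<close>

lemma impossible_outcome_AE:
  assumes m: "ontological_model \<Lambda> \<mu> \<xi>" and e: "explains \<Lambda> \<mu> \<xi> p" and z: "p k M P = 0"
  shows "AE l in \<Lambda>. \<xi> k M l * \<mu> P l = 0"
proof -
  have "(\<integral>l. \<xi> k M l * \<mu> P l \<partial>\<Lambda>) = 0" using e z by (simp add: explains_def)
  moreover have "AE l in \<Lambda>. 0 \<le> \<xi> k M l * \<mu> P l"
    using m by (intro AE_I2) (simp add: ontological_model_def)
  ultimately show ?thesis
    using integral_nonneg_eq_0_iff_AE[OF ontological_model_integrable[OF m]] by blast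
qed

lemma noncontextual_inequality:
  assumes sc: "interrogation_scenario p" and m: "ontological_model \<Lambda> \<mu> \<xi>"
    and e: "explains \<Lambda> \<mu> \<xi> p" and nc: "preparation_noncontextual \<Lambda> \<mu>"
  shows "p Out0 (Meas j) (Prep i) + p Out0 (Meas k) (Prep i) - p Out0 (Meas j) (Prep k) \<le> 1"
proof -
  \<comment> \<open>The integral of \<open>f\<close> is the left-hand side of the claim, so it
    suffices to bound \<open>f\<close> almost everywhere by a density, whose integral is 1.\<close>
  define f where "f = (\<lambda>l. \<xi> Out0 (Meas j) l * \<mu> (Prep i) l + \<xi> Out0 (Meas k) l * \<mu> (Prep i) l
      - \<xi> Out0 (Meas j) l * \<mu> (Prep k) l)"
  note int = ontological_model_integrable[OF m]
  have int_f: "integrable \<Lambda> f"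
    unfolding f_def
    by (intro Bochner_Integration.integrable_add Bochner_Integration.integrable_diff int)
  have "p Out1 (Meas k) (Prep k) = 0" "p Out0 (Meas k) (PrepPerp k) = 0"
    using sc scenario_probabilities(2)[OF sc]
    by (simp_all add: interrogation_scenario_def ideal_measurements_def)
  then have "AE l in \<Lambda>. \<xi> Out1 (Meas k) l * \<mu> (Prep k) l = 0"
      "AE l in \<Lambda>. \<xi> Out0 (Meas k) l * \<mu> (PrepPerp k) l = 0"
    using impossible_outcome_AE[OF m e] by blast+
  moreover have "AE l in \<Lambda>. 1/2 * \<mu> (Prep i) l + 1/2 * \<mu> (PrepPerp i) l
      = 1/2 * \<mu> (Prep k) l + 1/2 * \<mu> (PrepPerp k) l"
    using nc unfolding preparation_noncontextual_def by blast
  moreover have "AE l in \<Lambda>. l \<in> space \<Lambda>" by (rule AE_space)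
  ultimately have "AE l in \<Lambda>. f l \<le> \<mu> (Prep i) l"
  proof eventually_elim
    case (elim l)
    define x y S where "x = \<xi> Out0 (Meas j) l" and "y = \<xi> Out0 (Meas k) l"
      and "S = \<mu> (Prep k) l + \<mu> (PrepPerp k) l"
    have xy: "0 \<le> x" "0 \<le> y"
      using m elim(4) by (simp_all add: x_def y_def ontological_model_def)
    have le1: "x \<le> 1" "y \<le> 1"
      unfolding x_def y_def by (rule ontological_model_outcome_le_1[OF m elim(4)])+
    have "\<xi> Out1 (Meas k) l = 1 - y"
      using m elim(4) by (simp add: y_def ontological_model_def eq_diff_eq add.commute)
    then have "(1 - y) * \<mu> (Prep k) l = 0" "y * \<mu> (PrepPerp k) l = 0"
      using elim(1,2) by (simp_all add: y_def)
    \<comment> \<open>Where the density of \<open>Prep k\<close> is nonzero, \<open>y\<close> is 1;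
      where that of \<open>PrepPerp k\<close> is nonzero, \<open>y\<close> is 0. Hence multiplying
      \<open>S\<close> by \<open>y\<close> keeps exactly the first summand.\<close>
    then have G: "\<mu> (Prep k) l = y * S" by (auto simp: S_def)
    have nonneg: "0 \<le> \<mu> (Prep i) l" "0 \<le> \<mu> (PrepPerp i) l"
      using m elim(4) by (simp_all add: ontological_model_def)
    \<comment> \<open>Noncontextuality enters here: \<open>S\<close> is also the sum of the two
      densities for label \<open>i\<close>.\<close>
    have le_S: "\<mu> (Prep i) l \<le> S" using elim(3) nonneg by (simp add: S_def)
    have "x + y - 1 \<le> x * y"
      using mult_nonneg_nonneg[of "1 - x" "1 - y"] le1 by (simp add: algebra_simps)
    then have "\<mu> (Prep i) l * (x + y - 1) \<le> \<mu> (Prep i) l * (x * y)"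
      by (rule mult_left_mono) (rule nonneg)
    also have "\<dots> \<le> S * (x * y)"
      by (rule mult_right_mono[OF le_S]) (simp add: xy)
    finally have "\<mu> (Prep i) l * (x + y - 1) \<le> x * \<mu> (Prep k) l" by (simp add: G mult_ac)
    then show ?case by (simp add: f_def x_def y_def algebra_simps)
  qed
  then have "(\<integral>l. f l \<partial>\<Lambda>) \<le> (\<integral>l. \<mu> (Prep i) l \<partial>\<Lambda>)"
    by (intro integral_mono_AE int_f) (use m in \<open>simp_all add: ontological_model_def\<close>)
  also have "\<dots> = 1" using m by (simp add: ontological_model_def)
  finally show ?thesis
    using e int by (simp add: f_def explains_def)
qed

text \<open>With \<open>r\<close> for \<open>r_theta0 p\<close>, the symmetries turn the inequality
  for measurements 2 and 3 on preparation 1 into \<open>2 * r \<le> 1 + (2 * r - 1)^2\<close>.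
  Division by \<open>2 * (r + 1)\<close> gives the bound.\<close>

lemma noncontextual_efficiency_le:
  assumes sc: "interrogation_scenario p"
    and sym: "r_theta0 p = r_dag0 p" "r_theta1 p = r_dag1 p"
    and td: "r_theta_dag p = (r_theta0 p - r_theta1 p)^2"
    and m: "ontological_model \<Lambda> \<mu> \<xi>" and e: "explains \<Lambda> \<mu> \<xi> p"
    and nc: "preparation_noncontextual \<Lambda> \<mu>"
  shows "efficiency p \<le> eta_NC_opt (r_theta0 p)"
proof -
  let ?r = "r_theta0 p"
  have "p Out0 (Meas L2) (Prep L1) = ?r"
    using sc by (simp add: r_theta0_def interrogation_scenario_def symmetric_statistics_def)
  moreover have "p Out0 (Meas L3) (Prep L1) = ?r" using sym(1) by (simp add: r_dag0_def)
  moreover have "r_theta1 p = 1 - ?r"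
    using scenario_probabilities(2)[OF sc] by (simp add: r_theta0_def r_theta1_def)
  then have "p Out0 (Meas L2) (Prep L3) = (2 * ?r - 1)^2"
    using td by (simp add: r_theta_dag_def)
  ultimately have "2 * ?r \<le> 1 + (2 * ?r - 1)^2"
    using noncontextual_inequality[OF sc m e nc, of L2 L1 L3] by simp
  moreover have "0 \<le> ?r" using scenario_probabilities(1)[OF sc] by (simp add: r_theta0_def)
  ultimately have "2 * ?r / (2 * (?r + 1)) \<le> eta_NC_opt ?r"
    unfolding eta_NC_opt_def by (intro divide_right_mono) auto
  then show ?thesis
    by (simp only: efficiency_rewrite[OF sym(2)] mult_divide_mult_cancel_left_if) simp
qed

section \<open>Inner products and projectors in dimension two\<close>

text \<open>The Hermitian inner product, conjugate-linear in the first argument, expanded into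
  components for direct computation.\<close>

definition overlap :: "complex^2 \<Rightarrow> complex^2 \<Rightarrow> complex" where
  "overlap v w = cnj (v $ 1) * w $ 1 + cnj (v $ 2) * w $ 2"

lemma orthogonal_states_iff_overlap: "orthogonal_states v w \<longleftrightarrow> overlap v w = 0"
  by (simp add: orthogonal_states_def overlap_def sum_2)

lemma overlap_commute: "overlap w v = cnj (overlap v w)"
  by (simp add: overlap_def mult.commute)

lemma overlap_self: "overlap v v = of_real ((norm v)^2)"
  by (simp add: overlap_def norm_vec_def L2_set_def sum_2 complex_norm_square mult.commute
      del: of_real_power)

text \<open>The Born rule for pure states, which reduces all probabilities of outcome 0 to inner
  products.\<close>

lemma trace_projector_mult: "trace (projector v ** projector w) = of_real ((cmod (overlap v w))^2)"
  unfolding complex_norm_square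
  by (simp add: trace_def matrix_matrix_mult_def projector_def overlap_def sum_2 algebra_simps)

lemma trace_projector: "trace (projector v) = of_real ((norm v)^2)"
  unfolding overlap_self[symmetric]
  by (simp add: trace_def projector_def overlap_def sum_2 mult.commute)

text \<open>The completeness relation. The vector of \<open>PrepPerp i\<close> is known only up to a
  phase, so \<open>w\<close> is first recovered from orthonormality; its phase then cancels in the
  projector.\<close>

lemma projector_orthonormal_basis:
  assumes v: "norm v = 1" and w: "norm w = 1" and vw: "orthogonal_states v w"
  shows "projector v + projector w = mat 1"
proof -
  define a b c d where "a = v $ 1" and "b = v $ 2" and "c = w $ 1" and "d = w $ 2"
  \<comment> \<open>The determinant of the matrix with columns \<open>v\<close> and
    \<open>w\<close>, which turns out to be the unknown phase.\<close>
  define m where "m = a * d - b * c"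
  have vv: "cnj a * a + cnj b * b = 1"
    using overlap_self[of v] v by (simp add: overlap_def a_def b_def)
  have ww: "cnj c * c + cnj d * d = 1"
    using overlap_self[of w] w by (simp add: overlap_def c_def d_def)
  have o: "cnj a * c + cnj b * d = 0"
    using vw by (simp add: orthogonal_states_iff_overlap overlap_def a_def b_def c_def d_def)
  \<comment> \<open>in dimension 2, \<open>w\<close> is a phase times \<open>(- cnj b, cnj a)\<close>\<close>
  have c: "c = - cnj b * m" using vv o unfolding m_def by algebra
  have d: "d = cnj a * m" using vv o unfolding m_def by algebra
  \<comment> \<open>The squared norm of \<open>w\<close> is that of \<open>v\<close> times the
    squared modulus of \<open>m\<close>, so \<open>m\<close> has modulus 1.\<close>
  have "cnj m * m * (cnj a * a + cnj b * b) = 1"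
    using ww by (simp add: c d algebra_simps)
  then have m: "m * cnj m = 1" using vv by (simp add: mult.commute)
  \<comment> \<open>The four entries of the matrix sum. Conjugation is pushed down to the variables
    first, so that \<open>algebra\<close> faces polynomial identities in which conjugates are
    independent unknowns.\<close>
  have 1: "a * cnj a + c * cnj c = 1"
    using vv m unfolding c complex_cnj_mult complex_cnj_minus complex_cnj_cnj by algebra
  have 2: "b * cnj b + d * cnj d = 1"
    using vv m unfolding d complex_cnj_mult complex_cnj_cnj by algebra
  have 3: "a * cnj b + c * cnj d = 0"
    using m unfolding c d complex_cnj_mult complex_cnj_minus complex_cnj_cnj by algebra
  have 4: "b * cnj a + d * cnj c = 0"
    using m unfolding c d complex_cnj_mult complex_cnj_minus complex_cnj_cnj by algebra
  show ?thesis
    using 1 2 3 4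
    by (simp add: vec_eq_iff forall_2 projector_def mat_def a_def b_def c_def d_def)
qed

section \<open>The quantum realization\<close>

text \<open>The states are used below through these components; \<open>psi.simps\<close> leaves the
  simpset afterwards, since unfolding \<open>psi\<close> would keep these rules from
  matching.\<close>

lemma psi_component [simp]:
  "psi \<theta> L1 $ 1 = 1" "psi \<theta> L1 $ 2 = 0"
  "psi \<theta> L2 $ 1 = of_real (cos \<theta>)" "psi \<theta> L2 $ 2 = \<i> * of_real (sin \<theta>)"
  "psi \<theta> L3 $ 1 = of_real (cos \<theta>)" "psi \<theta> L3 $ 2 = - \<i> * of_real (sin \<theta>)"
  by (simp_all add: ket0_def U_def adjoint_matrix_def matrix_vector_mult_def sum_2)

declare psi.simps [simp del]

lemma norm_psi: "norm (psi \<theta> i) = 1"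
proof -
  have "(norm (psi \<theta> i))^2 = 1"
    by (cases i) (simp_all add: norm_vec_def L2_set_def sum_2 norm_mult)
  then show ?thesis by (simp add: power2_eq_iff_nonneg[where y = 1, simplified])
qed

text \<open>States 2 and 3 arise from state 1 by opposite rotations, so their mutual overlap is the
  cosine of the doubled angle. It is expanded to match the square in the third symmetry.\<close>

lemma overlap_psi:
  "overlap (psi \<theta> L1) (psi \<theta> L2) = of_real (cos \<theta>)"
  "overlap (psi \<theta> L3) (psi \<theta> L1) = of_real (cos \<theta>)"
  "overlap (psi \<theta> L2) (psi \<theta> L3) = of_real ((cos \<theta>)^2 - (sin \<theta>)^2)"
  by (simp_all add: overlap_def power2_eq_square algebra_simps)

lemma ex_quantum_preparations: "\<exists>s. quantum_preparations \<theta> s"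
proof -
  \<comment> \<open>In dimension 2, swapping and conjugating the components with one sign change
    gives an orthogonal vector of equal norm.\<close>
  define perp :: "complex^2 \<Rightarrow> complex^2" where "perp v = vector [- cnj (v $ 2), cnj (v $ 1)]" for v
  have "norm (perp v) = norm v" for v
    by (simp add: perp_def norm_vec_def L2_set_def sum_2 add.commute)
  moreover have "orthogonal_states v (perp v)" for v
    by (simp add: orthogonal_states_def perp_def sum_2 mult.commute)
  ultimately have "quantum_preparations \<theta> (case_prep (psi \<theta>) (\<lambda>i. perp (psi \<theta> i)))"
    by (simp add: quantum_preparations_def norm_psi)
  then show ?thesis by blast
qed

lemma norm_quantum_preparation:
  assumes "quantum_preparations \<theta> s"
  shows "norm (s P) = 1"
  using assms by (cases P) (simp_all add: quantum_preparations_def norm_psi)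

lemma quantum_statistics_Out0:
  "quantum_statistics \<theta> s Out0 (Meas i) P = (cmod (overlap (psi \<theta> i) (s P)))^2"
  by (simp add: quantum_statistics_def trace_projector_mult)

text \<open>The two effects sum to \<open>mat 1\<close>, and a unit vector's projector has trace
  1.\<close>

lemma quantum_statistics_Out1:
  assumes "quantum_preparations \<theta> s"
  shows "quantum_statistics \<theta> s Out1 M P = 1 - quantum_statistics \<theta> s Out0 M P"
proof (cases M)
  case (Meas i)
  have "trace ((mat 1 - projector (psi \<theta> i)) ** projector (s P))
      = trace (projector (s P)) - trace (projector (psi \<theta> i) ** projector (s P))"
    by (simp add: trace_def matrix_matrix_mult_def mat_def sum_2 algebra_simps)
  then show ?thesis
    by (simp add: Meas quantum_statistics_def trace_projector norm_quantum_preparation[OF assms])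
qed

text \<open>Each of the three mixtures is the maximally mixed state, half of
  \<open>mat 1\<close>.\<close>

lemma quantum_equivalences_preparations:
  assumes "quantum_preparations \<theta> s"
  shows "quantum_equivalences s"
proof -
  have "projector (s (Prep i)) + projector (s (PrepPerp i)) = mat 1" for i
    using assms norm_quantum_preparation[OF assms]
    by (intro projector_orthonormal_basis) (simp_all add: quantum_preparations_def norm_psi)
  then show ?thesis
    unfolding quantum_equivalences_def scaleR_add_right[symmetric] by simp
qed

text \<open>The Born rule is linear in the density matrix, so equal mixtures have equal
  statistics.\<close>

lemma quantum_operational_equivalences:
  assumes "quantum_equivalences s"
  shows "operational_equivalences (quantum_statistics \<theta> s)"
proof -
  have "1/2 * quantum_statistics \<theta> s k M (Prep i) + 1/2 * quantum_statistics \<theta> s k M (PrepPerp i)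
      = Re (trace (effect \<theta> k M **
          ((1/2) *\<^sub>R projector (s (Prep i)) + (1/2) *\<^sub>R projector (s (PrepPerp i)))))" for i k M
    by (simp add: quantum_statistics_def trace_def matrix_matrix_mult_def sum_2 algebra_simps)
  then show ?thesis
    using assms unfolding operational_equivalences_def quantum_equivalences_def by metis
qed

lemma quantum_interrogation_scenario:
  assumes q: "quantum_preparations \<theta> s"
  shows "interrogation_scenario (quantum_statistics \<theta> s)"
proof -
  let ?p = "quantum_statistics \<theta> s"
  have sP: "s (Prep i) = psi \<theta> i" for i using q by (simp add: quantum_preparations_def)
  \<comment> \<open>The Cauchy-Schwarz inequality, which keeps the Born probabilities at most
    1.\<close>
  have le1: "cmod (overlap v w) \<le> norm v * norm w" for v w
  proof -
    have "overlap v w = (\<Sum>i\<in>UNIV. cnj (v $ i) * w $ i)" by (simp add: overlap_def sum_2)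
    also have "cmod \<dots> \<le> (\<Sum>i\<in>UNIV. norm (v $ i) * norm (w $ i))"
      by (rule order_trans[OF norm_sum]) (simp add: norm_mult)
    also have "\<dots> \<le> norm v * norm w"
      using L2_set_mult_ineq[of "\<lambda>i. norm (v $ i)" "\<lambda>i. norm (w $ i)" UNIV]
      by (simp add: norm_vec_def)
    finally show ?thesis .
  qed
  have Out0: "0 \<le> ?p Out0 M P \<and> ?p Out0 M P \<le> 1" for M P
    using le1 norm_psi norm_quantum_preparation[OF q]
    by (cases M) (simp add: quantum_statistics_Out0 power_le_one_iff, metis mult_1)
  have "0 \<le> ?p k M P" for k M P
    using Out0[of M P] quantum_statistics_Out1[OF q] by (cases k) simp_all
  then have "probabilities ?p"
    using quantum_statistics_Out1[OF q] by (simp add: probabilities_def)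
  moreover have "operational_equivalences ?p"
    by (rule quantum_operational_equivalences[OF quantum_equivalences_preparations[OF q]])
  moreover have "ideal_measurements ?p"
    using q by (simp add: ideal_measurements_def quantum_statistics_Out0 sP overlap_self norm_psi
        quantum_preparations_def orthogonal_states_iff_overlap)
  moreover have "symmetric_statistics ?p"
    unfolding symmetric_statistics_def quantum_statistics_Out0 sP
    by (metis overlap_commute complex_mod_cnj)
  ultimately show ?thesis by (simp add: interrogation_scenario_def)
qed

lemma quantum_parameters:
  assumes q: "quantum_preparations \<theta> s" and p: "p = quantum_statistics \<theta> s"
  shows "r_theta0 p = (cos \<theta>)^2" "r_dag0 p = (cos \<theta>)^2"
    "r_theta1 p = (sin \<theta>)^2" "r_dag1 p = (sin \<theta>)^2"
    "r_theta_dag p = ((cos \<theta>)^2 - (sin \<theta>)^2)^2"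
proof -
  have sP: "s (Prep i) = psi \<theta> i" for i using q by (simp add: quantum_preparations_def)
  show "r_theta0 p = (cos \<theta>)^2" "r_dag0 p = (cos \<theta>)^2"
    "r_theta1 p = (sin \<theta>)^2" "r_dag1 p = (sin \<theta>)^2"
    by (simp_all add: p r_theta0_def r_dag0_def r_theta1_def r_dag1_def
        quantum_statistics_Out1[OF q] quantum_statistics_Out0 sP overlap_psi sin_squared_eq)
  show "r_theta_dag p = ((cos \<theta>)^2 - (sin \<theta>)^2)^2"
    unfolding p r_theta_dag_def quantum_statistics_Out0 sP overlap_psi norm_of_real by simp
qed

section \<open>The gap between quantum efficiency and noncontextual bound\<close>

lemma quantum_efficiency:
  assumes q: "quantum_preparations \<theta> s" and p: "p = quantum_statistics \<theta> s"
  shows "efficiency p = r_theta0 p / (r_theta0 p + 1)"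
  unfolding p
  by (rule efficiency_rewrite) (simp add: quantum_parameters[OF q])

text \<open>With \<open>r\<close> for \<open>r_theta0 p\<close>, the gap is
  \<open>(2 * r - 1) * (1 - r) / (r + 1)\<close>, positive exactly for \<open>r\<close> strictly
  between 1/2 and 1 within the unit interval. Expanding in \<open>r + 1\<close> separates the terms
  to be optimized.\<close>

lemma quantum_gap:
  assumes q: "quantum_preparations \<theta> s" and p: "p = quantum_statistics \<theta> s"
  shows "gap p = 7 - 2 * (r_theta0 p + 1) - 6 / (r_theta0 p + 1)"
proof -
  have "r_theta0 p + 1 > 0" by (simp add: quantum_parameters[OF q p] add_nonneg_pos)
  then show ?thesis
    unfolding gap_def quantum_efficiency[OF q p] eta_NC_opt_def
    by (simp add: divide_simps) (simp add: power2_eq_square algebra_simps)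
qed

text \<open>Choosing the angle \<open>arccos (sqrt r)\<close> makes the squared cosine equal to
  \<open>r\<close>. Maximizing over quantum realizations is thus maximizing over the whole unit
  interval.\<close>

lemma ex_quantum_r_theta0:
  assumes "r \<in> {0..1}"
  shows "\<exists>\<theta> s. quantum_preparations \<theta> s \<and> r_theta0 (quantum_statistics \<theta> s) = r"
proof -
  obtain s where s: "quantum_preparations (arccos (sqrt r)) s"
    using ex_quantum_preparations by blast
  have "r_theta0 (quantum_statistics (arccos (sqrt r)) s) = r"
    using assms real_sqrt_ge_zero[of r]
    by (simp add: quantum_parameters[OF s refl] cos_arccos order_trans[of "-1" 0])
  then show ?thesis using s by blast
qed

lemma gap_function_le:
  fixes u :: real
  assumes "u > 0"
  shows "7 - 2 * u - 6 / u \<le> 7 - 4 * sqrt 3"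
proof -
  \<comment> \<open>Twice this inequality, divided by \<open>u\<close>, is the required bound, with
    equality at \<open>u = sqrt 3\<close>.\<close>
  have "0 \<le> (u - sqrt 3)^2" by simp
  then have "4 * sqrt 3 * u \<le> 2 * u * u + 6"
    by (simp add: power2_eq_square algebra_simps)
  then show ?thesis using assms by (simp add: field_simps)
qed

text \<open>The precision is chosen for the maximal gap: these bounds place
  \<open>7 - 4 * sqrt 3\<close> strictly between 0.0712 and 0.072.\<close>

lemma sqrt_3_bounds: "1732/1000 < sqrt 3" "sqrt 3 < 17322/10000"
  by (rule real_less_rsqrt real_less_lsqrt; simp add: power2_eq_square)+

lemma quantum_gap_sqrt_3:
  assumes "quantum_preparations \<theta> s" "r_theta0 (quantum_statistics \<theta> s) = sqrt 3 - 1"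
  shows "gap (quantum_statistics \<theta> s) = 7 - 4 * sqrt 3"
proof -
  have "6 / sqrt 3 = 2 * sqrt 3" by (simp add: field_simps)
  then show ?thesis using quantum_gap[OF assms(1) refl] assms(2) by simp
qed

lemma quantum_gap_le:
  assumes q: "quantum_preparations \<theta> s"
  shows "gap (quantum_statistics \<theta> s) \<le> 7 - 4 * sqrt 3"
  unfolding quantum_gap[OF q refl]
  by (rule gap_function_le) (simp add: quantum_parameters[OF q refl] add_nonneg_pos)

theorem mainTheorem2:
  shows
    "(\<forall>p. interrogation_scenario p \<longrightarrow> r_theta0 p = r_dag0 p \<longrightarrow> r_theta1 p = r_dag1 p \<longrightarrow>
        (r_theta1 p \<noteq> 0 \<longrightarrow>
           r_theta0 p * r_dag1 p / (r_theta0 p * r_dag1 p + r_theta1 p)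
             = r_theta0 p / (r_theta0 p + 1)) \<and>
        efficiency p = r_theta0 p / (r_theta0 p + 1)) \<and>
     (\<forall>p (\<Lambda> :: 'l measure) \<mu> \<xi>.
        interrogation_scenario p \<longrightarrow> r_theta0 p = r_dag0 p \<longrightarrow> r_theta1 p = r_dag1 p \<longrightarrow>
        r_theta_dag p = (r_theta0 p - r_theta1 p)^2 \<longrightarrow>
        ontological_model \<Lambda> \<mu> \<xi> \<longrightarrow> explains \<Lambda> \<mu> \<xi> p \<longrightarrow> preparation_noncontextual \<Lambda> \<mu> \<longrightarrow>
        efficiency p \<le> eta_NC_opt (r_theta0 p)) \<and>
     (\<forall>\<theta>. \<exists>s. quantum_preparations \<theta> s) \<and>
     (\<forall>\<theta> s p. quantum_preparations \<theta> s \<longrightarrow> p = quantum_statistics \<theta> s \<longrightarrow>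
        quantum_equivalences s \<and> interrogation_scenario p \<and>
        r_theta0 p = r_dag0 p \<and> r_theta1 p = r_dag1 p \<and>
        r_theta_dag p = (r_theta0 p - r_theta1 p)^2 \<and>
        r_theta0 p = (cos \<theta>)^2 \<and>
        efficiency p = r_theta0 p / (r_theta0 p + 1) \<and>
        (r_theta0 p = 1/2 \<longrightarrow> efficiency p = 1/3 \<and> eta_NC_opt (r_theta0 p) = 1/3)) \<and>
     (\<forall>r\<in>{0..1}. \<exists>\<theta> s. quantum_preparations \<theta> s \<and> r_theta0 (quantum_statistics \<theta> s) = r) \<and>
     (\<exists>\<theta> s. quantum_preparations \<theta> s \<and>
        efficiency (quantum_statistics \<theta> s)
          > eta_NC_opt (r_theta0 (quantum_statistics \<theta> s))) \<and>
     (\<forall>\<theta>' s'. quantum_preparations \<theta>' s' \<longrightarrow>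
        r_theta0 (quantum_statistics \<theta>' s') = sqrt 3 - 1 \<longrightarrow>
        (\<forall>\<theta> s. quantum_preparations \<theta> s \<longrightarrow>
           gap (quantum_statistics \<theta> s) \<le> gap (quantum_statistics \<theta>' s')) \<and>
        71/1000 \<le> gap (quantum_statistics \<theta>' s') \<and>
        gap (quantum_statistics \<theta>' s') < 72/1000) \<and>
     \<bar>sqrt 3 - 1 - 73/100 :: real\<bar> < 5/1000"
proof (intro conjI)
  show "\<forall>p. interrogation_scenario p \<longrightarrow> r_theta0 p = r_dag0 p \<longrightarrow> r_theta1 p = r_dag1 p \<longrightarrow>
        (r_theta1 p \<noteq> 0 \<longrightarrow>
           r_theta0 p * r_dag1 p / (r_theta0 p * r_dag1 p + r_theta1 p)
             = r_theta0 p / (r_theta0 p + 1)) \<and>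
        efficiency p = r_theta0 p / (r_theta0 p + 1)"
    using efficiency_cancel efficiency_rewrite by blast
  show "\<forall>p (\<Lambda> :: 'l measure) \<mu> \<xi>.
        interrogation_scenario p \<longrightarrow> r_theta0 p = r_dag0 p \<longrightarrow> r_theta1 p = r_dag1 p \<longrightarrow>
        r_theta_dag p = (r_theta0 p - r_theta1 p)^2 \<longrightarrow>
        ontological_model \<Lambda> \<mu> \<xi> \<longrightarrow> explains \<Lambda> \<mu> \<xi> p \<longrightarrow> preparation_noncontextual \<Lambda> \<mu> \<longrightarrow>
        efficiency p \<le> eta_NC_opt (r_theta0 p)"
    by (intro allI impI) (rule noncontextual_efficiency_le)
  show "\<forall>\<theta>. \<exists>s. quantum_preparations \<theta> s" by (simp add: ex_quantum_preparations)
  show "\<forall>\<theta> s p. quantum_preparations \<theta> s \<longrightarrow> p = quantum_statistics \<theta> s \<longrightarrow>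
        quantum_equivalences s \<and> interrogation_scenario p \<and>
        r_theta0 p = r_dag0 p \<and> r_theta1 p = r_dag1 p \<and>
        r_theta_dag p = (r_theta0 p - r_theta1 p)^2 \<and>
        r_theta0 p = (cos \<theta>)^2 \<and>
        efficiency p = r_theta0 p / (r_theta0 p + 1) \<and>
        (r_theta0 p = 1/2 \<longrightarrow> efficiency p = 1/3 \<and> eta_NC_opt (r_theta0 p) = 1/3)"
  proof (intro allI impI)
    fix \<theta> s p assume q: "quantum_preparations \<theta> s" and p: "p = quantum_statistics \<theta> s"
    have "efficiency p = 1/3 \<and> eta_NC_opt (r_theta0 p) = 1/3" if "r_theta0 p = 1/2"
      by (simp add: quantum_efficiency[OF q p] eta_NC_opt_def that)
    then show "quantum_equivalences s \<and> interrogation_scenario p \<and>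
        r_theta0 p = r_dag0 p \<and> r_theta1 p = r_dag1 p \<and>
        r_theta_dag p = (r_theta0 p - r_theta1 p)^2 \<and>
        r_theta0 p = (cos \<theta>)^2 \<and>
        efficiency p = r_theta0 p / (r_theta0 p + 1) \<and>
        (r_theta0 p = 1/2 \<longrightarrow> efficiency p = 1/3 \<and> eta_NC_opt (r_theta0 p) = 1/3)"
      using quantum_equivalences_preparations[OF q] quantum_interrogation_scenario[OF q]
        quantum_efficiency[OF q p]
      by (simp add: quantum_parameters[OF q p] p[symmetric])
  qed
  show "\<forall>r\<in>{0..1}. \<exists>\<theta> s. quantum_preparations \<theta> s \<and> r_theta0 (quantum_statistics \<theta> s) = r"
    using ex_quantum_r_theta0 by blast
  show "\<exists>\<theta> s. quantum_preparations \<theta> s \<and>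
        efficiency (quantum_statistics \<theta> s)
          > eta_NC_opt (r_theta0 (quantum_statistics \<theta> s))"
  proof -
    \<comment> \<open>The maximizer itself witnesses the violation, since its gap
      \<open>7 - 4 * sqrt 3\<close> is positive.\<close>
    have "sqrt 3 - 1 \<in> {0..1}" using sqrt_3_bounds by simp
    then obtain \<theta> s where q: "quantum_preparations \<theta> s"
        and r: "r_theta0 (quantum_statistics \<theta> s) = sqrt 3 - 1"
      using ex_quantum_r_theta0 by blast
    have "gap (quantum_statistics \<theta> s) > 0"
      using quantum_gap_sqrt_3[OF q r] sqrt_3_bounds by simp
    then show ?thesis using q by (auto simp: gap_def)
  qed
  show "\<forall>\<theta>' s'. quantum_preparations \<theta>' s' \<longrightarrow>
        r_theta0 (quantum_statistics \<theta>' s') = sqrt 3 - 1 \<longrightarrow>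
        (\<forall>\<theta> s. quantum_preparations \<theta> s \<longrightarrow>
           gap (quantum_statistics \<theta> s) \<le> gap (quantum_statistics \<theta>' s')) \<and>
        71/1000 \<le> gap (quantum_statistics \<theta>' s') \<and>
        gap (quantum_statistics \<theta>' s') < 72/1000"
    using quantum_gap_le sqrt_3_bounds by (simp add: quantum_gap_sqrt_3)
  show "\<bar>sqrt 3 - 1 - 73/100 :: real\<bar> < 5/1000"
    using sqrt_3_bounds by simp
qed

end
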